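(* Let $m<n$, let $\widetilde{x}\in\mathbb{R}^n$ be a $k$-sparse vector with (nonempty) support $S\subset\{1,\dots,n\}$ and complement $S^C=\{1,\dots,n\}\setminus S$, and let $c=\min_{i\in S}|\widetilde{x}_i|$ and $d=\max_{i\in S}|\widetilde{x}_i|$. Let $A\in\mathbb{R}^{m\times n}$ and $y=A\widetilde{x}\in\mathbb{R}^m$. Let $\overline{y}=y+\delta_y$ and $\overline{A}=A+\delta_A$, where $\delta_y\in\mathbb{R}^m$ and $\delta_A\in\mathbb{R}^{m\times n}$ satisfy $\|\delta_y\|_\infty\le\Delta_y$ and $\|\delta_A\|_\infty\le\Delta_A$. Assume that $\overline{A}$ has maximum rank $m$ and that its columns are $\ell_2$-normalized. Assume that the right generalized sign vector $s(\widetilde{x})$ of $\widetilde{x}$ is available, and let $z^\star$ be a solution of the linear program $$\min_{z\in\mathbb{R}^n_+}\ \sum_{i=1}^n z_i\quad\text{s.t.}\quad Cz\preceq g,$$ $$C=\begin{pmatrix}(\mathbf{1}_m s(\widetilde{x})^T)\bullet\overline{A}-\Delta_A\mathbf{1}_m\mathbf{1}_n^T\\ -(\mathbf{1}_m s(\widetilde{x})^T)\bullet\overline{A}-\Delta_A\mathbf{1}_m\mathbf{1}_n^T\end{pmatrix}\in\mathbb{R}^{2m\times n},\qquad g=\begin{pmatrix}\overline{y}+\Delta_y\mathbf{1}_m\\ -\overline{y}+\Delta_y\mathbf{1}_m\end{pmatrix}\in\mathbb{R}^{2m},$$ with associated estimate $\beta=s(\widetilde{x})\bullet z^\star$ of $\widetilde{x}$.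 Let $\widehat{k}$ be the estimated sparsity level, i.e. the number of nonzero components of $\beta$, and let $$\phi:=\sqrt{m}\,\big(2\Delta_y+\Delta_A(k+\widehat{k})d\big),$$ $$\gamma(\overline{A}):=\max_{i\in S}\sum_{l\in S,\,l\ne i}|\overline{A}_i^T\overline{A}_l|+\max_{j\in S^C}\sum_{l\in S}|\overline{A}_j^T\overline{A}_l|,$$ where $\overline{A}_i$ is the $i$-th column of $\overline{A}$. Let $\tau$ be the polishing threshold, with $0<\tau\le\frac{c}{2}$. If there exists $\xi>0$ such that $$\phi k\le\tau\xi\qquad\text{and}\qquad\gamma(\overline{A})\le 1-2\xi,$$ then the solution of the linear program exactly provides $S$, i.e. it selects the correct significant parameters: after setting to zero all the components of $\beta$ with magnitude smaller than $\tau$, the support of the resulting vector is $S$.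
   Context: The support of a vector is the set of indices of its nonzero components; $k$-sparse means having $k$ nonzero components. The norm $\|\cdot\|_\infty$ of a vector or of a matrix is the maximum absolute value of its entries. $\mathbf{1}_n=(1,\dots,1)^T\in\mathbb{R}^n$, $\bullet$ is the component-wise product, $\preceq$ is component-wise inequality, and $\mathbb{R}^n_+$ is the set of vectors with nonnegative components. Generalized signs: for $v\in\mathbb{R}^n$, a vector $s(v)\in\{-1,1\}^n$ is a generalized sign vector of $v$ if $s_i(v)=1$ implies $v_i\ge 0$ and $s_i(v)=-1$ implies $v_i\le 0$ (both values are allowed where $v_i=0$, so $s(v)$ is not unique); then $v=s(v)\bullet|v|$ with $|v|=(|v_1|,\dots,|v_n|)^T$. Polishing: in the final estimate all components with magnitude smaller than the threshold $\tau$ are considered as null; one takes $\tau=\frac{c}{2}$ if $c$ is known, and otherwise a lower bound $\tau<\frac{c}{2}$. *)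

theory Defs
  imports "HOL-Analysis.Analysis"
begin

definition support :: "real^'n \<Rightarrow> 'n set" where
  "support v = {i. v $ i \<noteq> 0}"

definition gen_sign :: "real^'n \<Rightarrow> real^'n \<Rightarrow> bool" where
  "gen_sign v s \<longleftrightarrow>
     (\<forall>i. s $ i \<in> {-1, 1} \<and> (s $ i = 1 \<longrightarrow> 0 \<le> v $ i) \<and> (s $ i = -1 \<longrightarrow> v $ i \<le> 0))"

text \<open>The norm of a vector or matrix with subscript infinity is the library's
  \<^const>\<open>infnorm\<close>. A matrix is a vector of rows, whose canonical basis consists of the
  matrix units, so that \<^const>\<open>infnorm\<close> of a matrix is the maximum absolute value of its
  entries and not an operator norm.\<close>

lemma infnorm_matrix_le_iff:
  fixes M :: "real^'n^'m"
  shows "infnorm M \<le> B \<longleftrightarrow> (\<forall>i j. \<bar>M $ i $ j\<bar> \<le> B)"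
proof -
  have "infnorm M \<le> B \<longleftrightarrow> (\<forall>b\<in>Basis. \<bar>M \<bullet> b\<bar> \<le> B)"
    unfolding infnorm_Max by (subst Max_le_iff) auto
  also have "\<dots> \<longleftrightarrow> (\<forall>i j. \<bar>M $ i $ j\<bar> \<le> B)"
    by (auto simp: Basis_vec_def inner_axis)
  finally show ?thesis .
qed

text \<open>Vertical concatenation of two vectors or, row by row, of two matrices; the sum type
  \<open>'m + 'm\<close> indexes the \<open>2 m\<close> resulting components or rows.\<close>

definition stack :: "'a^'m \<Rightarrow> 'a^'m \<Rightarrow> 'a^('m + 'm)" where
  "stack P Q = (\<chi> p. case p of Inl i \<Rightarrow> P $ i | Inr i \<Rightarrow> Q $ i)"

text \<open>In the next definitions \<open>*\<close> is the component-wise product (for matrices, entry by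
  entry), \<open>1\<close> is the vector or matrix of all ones, \<open>\<le>\<close> on vectors is component-wise, and
  \<open>rowvector s\<close>, whose number of rows is fixed by its type, is the matrix all of whose
  rows are \<open>s\<close>.\<close>

definition lp_matrix :: "real^'n \<Rightarrow> real^'n^'m \<Rightarrow> real \<Rightarrow> real^'n^('m + 'm)" where
  "lp_matrix s A \<Delta> =
     stack (rowvector s * A - \<Delta> *\<^sub>R 1) (- (rowvector s * A) - \<Delta> *\<^sub>R 1)"

definition lp_bound :: "real^'m \<Rightarrow> real \<Rightarrow> real^('m + 'm)" where
  "lp_bound y \<Delta> = stack (y + \<Delta> *\<^sub>R 1) (- y + \<Delta> *\<^sub>R 1)"

definition lp_solution :: "real^'n^'p \<Rightarrow> real^'p \<Rightarrow> real^'n \<Rightarrow> bool" where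
  "lp_solution C g z \<longleftrightarrow> is_arg_min (\<lambda>z. \<Sum>i\<in>UNIV. z $ i) (\<lambda>z. 0 \<le> z \<and> C *v z \<le> g) z"

text \<open>A maximum over an empty index set is taken to be \<open>0\<close>. Below this is relevant only when
  \<open>S\<close> or its complement is empty.\<close>

definition max_over :: "'a set \<Rightarrow> ('a \<Rightarrow> real) \<Rightarrow> real" where
  "max_over I f = (if I = {} then 0 else Max (f ` I))"

definition coherence :: "'n set \<Rightarrow> real^'n^'m \<Rightarrow> real" where
  "coherence S A =
     max_over S (\<lambda>i. \<Sum>l\<in>S - {i}. \<bar>column i A \<bullet> column l A\<bar>) +
     max_over (- S) (\<lambda>j. \<Sum>l\<in>S. \<bar>column j A \<bullet> column l A\<bar>)"

definition polish :: "real \<Rightarrow> real^'n \<Rightarrow> real^'n" where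
  "polish \<tau> v = (\<chi> i. if \<bar>v $ i\<bar> < \<tau> then 0 else v $ i)"

end

theory Submission
  imports Defs
begin

text \<open>
  The magnitude vector \<open>w = |x|\<close> of the true parameter is feasible for the linear program,
  because the constraints only ask that the residual be no larger than the admitted
  perturbations of \<open>y\<close> and \<open>A\<close> can make it, and for \<open>x\<close> it is not larger. Two consequences follow for the
  error \<open>h = \<beta> - x\<close>.

  First, optimality gives \<open>\<Sum> z \<le> \<Sum> |x|\<close>, and as \<open>x\<close> vanishes off \<open>S\<close>, the \<open>l1\<close> mass of \<open>h\<close>
  off \<open>S\<close> is at most its mass \<open>H\<close> on \<open>S\<close>. Second, both \<open>x\<close> and \<open>\<beta>\<close> nearly explain
  the same data, so every component of \<open>Abar h\<close> is at most
  \<open>2 \<Delta>y + \<Delta>A (\<Sum> z + \<Sum> |x|) \<le> 2 \<Delta>y + 2 \<Delta>A k d\<close>. On such a cone, small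
  coherence lets the diagonal of the Gram matrix prevail: the lemma \<open>coherence_cone_bound\<close>
  gives \<open>(1 - coherence) H \<le> k (norm (Abar h))\<close>, so \<open>2 \<xi> H \<le> k \<psi>\<close> with
  \<open>\<psi> = sqrt m (2 \<Delta>y + 2 \<Delta>A k d)\<close>.

  It remains to compare \<open>\<psi>\<close> with \<open>\<phi>\<close>, in which \<open>k + khat\<close> takes the place of \<open>2 k\<close>.
  This is done by a bootstrap. In any case \<open>2 k \<le> 2 (k + khat)\<close>, hence \<open>\<psi> \<le> 2 \<phi>\<close>
  and \<open>H \<le> \<tau> < c\<close>. An error below \<open>c\<close> cannot annihilate a component in \<open>S\<close>, so the
  support of \<open>\<beta>\<close> contains \<open>S\<close> and \<open>k \<le> khat\<close>. Now \<open>\<psi> \<le> \<phi>\<close>, which improves the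
  estimate to \<open>H \<le> \<tau> / 2\<close>. Every component of \<open>h\<close> is thus at most \<open>\<tau> / 2\<close>: off \<open>S\<close>
  the estimate stays below the threshold, and on \<open>S\<close> it is at least
  \<open>c - \<tau> / 2 \<ge> 3 \<tau> / 2\<close>.
\<close>

section \<open>Constraints of the linear program\<close>

text \<open>The two blocks of rows are the two one-sided halves of a bound on the absolute
  residual. If \<open>w \<ge> 0\<close> and the entries of \<open>s\<close> are signs, the slack \<open>D (\<Sum> w)\<close> is the worst effect that a matrix
  perturbation with entries at most \<open>D\<close> can have on the signed vector \<open>s * w\<close>.\<close>

lemma lp_feasible_iff:
  fixes s w :: "real^'n" and B :: "real^'n^'m"
  shows "lp_matrix s B D *v w \<le> lp_bound b E \<longleftrightarrow>
    (\<forall>i. \<bar>(B *v (s * w)) $ i - b $ i\<bar> \<le> E + D * (\<Sum>j\<in>UNIV. w $ j))"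
proof -
  have Inl: "(lp_matrix s B D *v w) $ Inl i = (B *v (s * w)) $ i - D * (\<Sum>j\<in>UNIV. w $ j)" for i
    by (simp add: lp_matrix_def stack_def matrix_vector_mult_def rowvector_def
        sum_subtractf sum_distrib_left algebra_simps)
  have Inr: "(lp_matrix s B D *v w) $ Inr i = - (B *v (s * w)) $ i - D * (\<Sum>j\<in>UNIV. w $ j)" for i
    by (simp add: lp_matrix_def stack_def matrix_vector_mult_def rowvector_def
        sum_subtractf sum_distrib_left sum_negf algebra_simps)
  have bound: "lp_bound b E $ Inl i = b $ i + E" "lp_bound b E $ Inr i = - b $ i + E" for i
    by (simp_all add: lp_bound_def stack_def)
  have "lp_matrix s B D *v w \<le> lp_bound b E \<longleftrightarrow>
      (\<forall>i. (lp_matrix s B D *v w) $ Inl i \<le> lp_bound b E $ Inl i) \<and>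
      (\<forall>i. (lp_matrix s B D *v w) $ Inr i \<le> lp_bound b E $ Inr i)"
    unfolding less_eq_vec_def by (metis old.sum.exhaust)
  also have "\<dots> \<longleftrightarrow>
      (\<forall>i. \<bar>(B *v (s * w)) $ i - b $ i\<bar> \<le> E + D * (\<Sum>j\<in>UNIV. w $ j))"
    unfolding Inl Inr bound abs_le_iff all_conj_distrib[symmetric]
    by (intro iff_allI) (auto simp: algebra_simps)
  finally show ?thesis .
qed

lemma gen_sign_abs:
  assumes "gen_sign v s"
  shows "s $ i * \<bar>v $ i\<bar> = v $ i" and "\<bar>s $ i\<bar> = 1"
proof -
  have "s $ i \<in> {-1, 1}" "s $ i = 1 \<longrightarrow> 0 \<le> v $ i" "s $ i = -1 \<longrightarrow> v $ i \<le> 0"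
    using assms unfolding gen_sign_def by blast+
  then show "s $ i * \<bar>v $ i\<bar> = v $ i" and "\<bar>s $ i\<bar> = 1" by auto
qed

lemma abs_matrix_vector_mult_le:
  fixes E :: "real^'n^'m"
  assumes "infnorm E \<le> D"
  shows "\<bar>(E *v v) $ i\<bar> \<le> D * (\<Sum>j\<in>UNIV. \<bar>v $ j\<bar>)"
proof -
  have "\<bar>(E *v v) $ i\<bar> \<le> (\<Sum>j\<in>UNIV. \<bar>E $ i $ j * v $ j\<bar>)"
    unfolding matrix_vector_mult_def by (simp add: sum_abs)
  also have "\<dots> \<le> (\<Sum>j\<in>UNIV. D * \<bar>v $ j\<bar>)"
    using assms unfolding infnorm_matrix_le_iff
    by (intro sum_mono) (auto simp: abs_mult intro: mult_right_mono)
  finally show ?thesis by (simp add: sum_distrib_left)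
qed

lemma norm_le_sqrt_card:
  fixes v :: "real^'m"
  assumes "\<And>i. \<bar>v $ i\<bar> \<le> B"
  shows "norm v \<le> sqrt (real CARD('m)) * B"
proof -
  have "infnorm v \<le> B"
    unfolding infnorm_Max by (subst Max_le_iff) (auto simp: Basis_vec_def inner_axis assms)
  with norm_le_infnorm[of v] show ?thesis
    by (simp add: order_trans[OF _ mult_left_mono])
qed

section \<open>Recovery from small coherence\<close>

lemma le_max_over:
  fixes I :: "'a::finite set"
  assumes "i \<in> I"
  shows "f i \<le> max_over I f"
  using assms unfolding max_over_def by auto

lemma max_over_nonneg:
  fixes I :: "'a::finite set"
  assumes "\<And>i. i \<in> I \<Longrightarrow> 0 \<le> f i"
  shows "0 \<le> max_over I f"
proof (cases "I = {}")
  case False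
  then obtain i where "i \<in> I" by blast
  then show ?thesis using assms le_max_over order_trans by metis
qed (simp add: max_over_def)

lemma sum_weighted_le_max_over:
  fixes f u :: "'a::finite \<Rightarrow> real"
  assumes "\<And>l. 0 \<le> u l"
  shows "(\<Sum>l\<in>I. f l * u l) \<le> max_over I f * (\<Sum>l\<in>I. u l)"
  unfolding sum_distrib_left
  by (intro sum_mono mult_right_mono assms le_max_over)

text \<open>Row \<open>i\<close> of the Gram matrix expresses \<open>h $ i\<close> through the correlation of column
  \<open>i\<close> with \<open>B *v h\<close>, at most \<open>norm (B *v h)\<close>, and the remaining entries of \<open>h\<close>. When
  this is summed over \<open>S\<close> and the order of summation exchanged, the weight of each
  \<open>\<bar>h $ l\<bar>\<close> becomes a column sum over \<open>S\<close>, which is what the two maxima in the coherence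
  bound; the cone condition turns the part off \<open>S\<close> into one on \<open>S\<close>.\<close>

lemma coherence_cone_bound:
  fixes B :: "real^'n^'m" and h :: "real^'n"
  assumes unit: "\<And>j. norm (column j B) = 1"
    and cone: "(\<Sum>j\<in>-S. \<bar>h $ j\<bar>) \<le> (\<Sum>j\<in>S. \<bar>h $ j\<bar>)"
  shows "(1 - coherence S B) * (\<Sum>i\<in>S. \<bar>h $ i\<bar>) \<le> real (card S) * norm (B *v h)"
proof -
  define G where "G i l = column i B \<bullet> column l B" for i l
  have G_sym: "G i l = G l i" for i l by (simp add: G_def inner_commute)
  have Bh: "column i B \<bullet> (B *v h) = (\<Sum>l\<in>UNIV. G i l * h $ l)" for i
    by (simp add: matrix_mult_sum inner_sum_right G_def scalar_mult_eq_scaleR mult.commute)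
  define \<mu> where "\<mu> = max_over S (\<lambda>l. \<Sum>i\<in>S - {l}. \<bar>G l i\<bar>)"
  define \<nu> where "\<nu> = max_over (- S) (\<lambda>l. \<Sum>i\<in>S. \<bar>G l i\<bar>)"
  have nu: "0 \<le> \<nu>" unfolding \<nu>_def by (intro max_over_nonneg sum_nonneg) auto
  have row: "\<bar>h $ i\<bar> \<le> norm (B *v h) + (\<Sum>l\<in>S - {i}. \<bar>G i l\<bar> * \<bar>h $ l\<bar>)
      + (\<Sum>l\<in>-S. \<bar>G i l\<bar> * \<bar>h $ l\<bar>)" if "i \<in> S" for i
  proof -
    have "(\<Sum>l\<in>UNIV. G i l * h $ l) = (\<Sum>l\<in>S. G i l * h $ l) + (\<Sum>l\<in>-S. G i l * h $ l)"
      by (subst sum.union_disjoint[symmetric]) auto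
    also have "(\<Sum>l\<in>S. G i l * h $ l) = G i i * h $ i + (\<Sum>l\<in>S - {i}. G i l * h $ l)"
      using that by (simp add: sum.remove)
    also have "G i i = 1" using unit[of i] by (simp add: G_def norm_eq_1)
    finally have "h $ i = column i B \<bullet> (B *v h) - (\<Sum>l\<in>S - {i}. G i l * h $ l)
        - (\<Sum>l\<in>-S. G i l * h $ l)" using Bh by simp
    moreover have "\<bar>column i B \<bullet> (B *v h)\<bar> \<le> norm (B *v h)"
      using Cauchy_Schwarz_ineq2[of "column i B" "B *v h"] unit[of i] by simp
    moreover have "\<bar>\<Sum>l\<in>T. G i l * h $ l\<bar> \<le> (\<Sum>l\<in>T. \<bar>G i l\<bar> * \<bar>h $ l\<bar>)" for T
      by (simp add: sum_abs flip: abs_mult)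
    ultimately show ?thesis by (smt (verit))
  qed
  have off: "(\<Sum>i\<in>S. \<Sum>l\<in>S - {i}. \<bar>G i l\<bar> * \<bar>h $ l\<bar>) \<le> \<mu> * (\<Sum>i\<in>S. \<bar>h $ i\<bar>)"
  proof -
    have "(\<Sum>i\<in>S. \<Sum>l\<in>S - {i}. \<bar>G i l\<bar> * \<bar>h $ l\<bar>) =
        (\<Sum>i\<in>S. \<Sum>l | l \<in> S \<and> i \<noteq> l. \<bar>G i l\<bar> * \<bar>h $ l\<bar>)"
      by (intro sum.cong) auto
    also have "\<dots> = (\<Sum>l\<in>S. \<Sum>i | i \<in> S \<and> i \<noteq> l. \<bar>G i l\<bar> * \<bar>h $ l\<bar>)"
      by (rule sum.swap_restrict) auto
    also have "\<dots> = (\<Sum>l\<in>S. (\<Sum>i\<in>S - {l}. \<bar>G l i\<bar>) * \<bar>h $ l\<bar>)"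
      unfolding sum_distrib_right by (intro sum.cong) (auto simp: G_sym)
    also have "\<dots> \<le> \<mu> * (\<Sum>i\<in>S. \<bar>h $ i\<bar>)"
      unfolding \<mu>_def by (rule sum_weighted_le_max_over) simp
    finally show ?thesis .
  qed
  have "(\<Sum>i\<in>S. \<Sum>l\<in>-S. \<bar>G i l\<bar> * \<bar>h $ l\<bar>) = (\<Sum>l\<in>-S. (\<Sum>i\<in>S. \<bar>G l i\<bar>) * \<bar>h $ l\<bar>)"
    by (subst sum.swap) (simp add: sum_distrib_right G_sym)
  also have "\<dots> \<le> \<nu> * (\<Sum>l\<in>-S. \<bar>h $ l\<bar>)"
    unfolding \<nu>_def by (rule sum_weighted_le_max_over) simp
  also have "\<dots> \<le> \<nu> * (\<Sum>l\<in>S. \<bar>h $ l\<bar>)"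
    by (rule mult_left_mono[OF cone nu])
  finally have out: "(\<Sum>i\<in>S. \<Sum>l\<in>-S. \<bar>G i l\<bar> * \<bar>h $ l\<bar>) \<le> \<nu> * (\<Sum>l\<in>S. \<bar>h $ l\<bar>)" .
  have "(\<Sum>i\<in>S. \<bar>h $ i\<bar>) \<le> (\<Sum>i\<in>S. norm (B *v h) + (\<Sum>l\<in>S - {i}. \<bar>G i l\<bar> * \<bar>h $ l\<bar>)
      + (\<Sum>l\<in>-S. \<bar>G i l\<bar> * \<bar>h $ l\<bar>))"
    by (rule sum_mono[OF row])
  also have "\<dots> \<le> real (card S) * norm (B *v h) + (\<mu> + \<nu>) * (\<Sum>i\<in>S. \<bar>h $ i\<bar>)"
    using off out by (simp add: sum.distrib distrib_right)
  finally show ?thesis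
    by (simp add: coherence_def \<mu>_def \<nu>_def G_def algebra_simps)
qed

section \<open>Exact recovery of the support\<close>

theorem theorem2:
  fixes x s z \<beta> :: "real^'n"
    and A Abar \<delta>A :: "real^'n^'m"
    and y ybar \<delta>y :: "real^'m"
    and S :: "'n set"
    and k khat :: nat
    and c d \<Delta>y \<Delta>A \<phi> \<tau> :: real
  assumes "CARD('m) < CARD('n)"
    and "S = support x" and "S \<noteq> {}" and "k = card S"
    and "c = Min ((\<lambda>i. \<bar>x $ i\<bar>) ` S)"
    and "d = Max ((\<lambda>i. \<bar>x $ i\<bar>) ` S)"
    and "y = A *v x"
    and "ybar = y + \<delta>y" and "Abar = A + \<delta>A"
    and "infnorm \<delta>y \<le> \<Delta>y" and "infnorm \<delta>A \<le> \<Delta>A"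
    and "rank Abar = CARD('m)"
    and "\<And>j. norm (column j Abar) = 1"
    and "gen_sign x s"
    and "lp_solution (lp_matrix s Abar \<Delta>A) (lp_bound ybar \<Delta>y) z"
    and "\<beta> = s * z"
    and "khat = card (support \<beta>)"
    and "\<phi> = sqrt (real CARD('m)) * (2 * \<Delta>y + \<Delta>A * real (k + khat) * d)"
    and "0 < \<tau>" and "\<tau> \<le> c / 2"
    and "\<exists>\<xi>>0. \<phi> * real k \<le> \<tau> * \<xi> \<and> coherence S Abar \<le> 1 - 2 * \<xi>"
  shows "support (polish \<tau> \<beta>) = S"
proof -
  have gs: "s $ i * \<bar>x $ i\<bar> = x $ i" "\<bar>s $ i\<bar> = 1" for i
    using gen_sign_abs[OF \<open>gen_sign x s\<close>] by auto
  have off_S: "x $ i = 0" if "i \<notin> S" for i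
    using that assms(2) by (simp add: support_def)
  have x_ge: "c \<le> \<bar>x $ i\<bar>" and x_le: "\<bar>x $ i\<bar> \<le> d" if "i \<in> S" for i
    using that unfolding assms(5,6) by auto
  have \<Delta>: "0 \<le> \<Delta>y" "0 \<le> \<Delta>A"
    using assms(10,11) infnorm_pos_le order_trans by blast+
  have d_nonneg: "0 \<le> d"
    using x_le \<open>S \<noteq> {}\<close> by (meson abs_ge_zero ex_in_conv order_trans)
  \<comment> \<open>The true magnitudes are feasible, so their sum \<open>X\<close> bounds the optimal value.\<close>
  define X where "X = (\<Sum>i\<in>UNIV. \<bar>x $ i\<bar>)"
  define w where "w = (\<chi> i. \<bar>x $ i\<bar>)"
  have sw: "s * w = x"
    by (simp add: vec_eq_iff w_def gs)
  have X_S: "X = (\<Sum>i\<in>S. \<bar>x $ i\<bar>)"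
    unfolding X_def by (rule sum.mono_neutral_right) (auto simp: off_S)
  have X_le: "X \<le> real k * d"
    unfolding X_S assms(4) by (rule sum_bounded_above[OF x_le])
  have fit_x: "\<bar>(Abar *v x) $ i - ybar $ i\<bar> \<le> \<Delta>y + \<Delta>A * X" for i
  proof -
    have "(Abar *v x) $ i - ybar $ i = (\<delta>A *v x) $ i - \<delta>y $ i"
      by (simp add: assms(7-9) matrix_vector_mult_add_rdistrib)
    moreover have "\<bar>\<delta>y $ i\<bar> \<le> \<Delta>y"
      using assms(10) component_le_infnorm_cart[of \<delta>y i] by simp
    moreover have "\<bar>(\<delta>A *v x) $ i\<bar> \<le> \<Delta>A * X"
      unfolding X_def by (rule abs_matrix_vector_mult_le[OF assms(11)])
    ultimately show ?thesis by (smt (verit))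
  qed
  have feasible_w: "0 \<le> w \<and> lp_matrix s Abar \<Delta>A *v w \<le> lp_bound ybar \<Delta>y"
    unfolding lp_feasible_iff sw using fit_x
    by (auto simp: less_eq_vec_def w_def X_def)
  have feasible_z: "0 \<le> z" "lp_matrix s Abar \<Delta>A *v z \<le> lp_bound ybar \<Delta>y"
    and opt: "(\<Sum>i\<in>UNIV. z $ i) \<le> X"
    using assms(15) feasible_w
    unfolding lp_solution_def is_arg_min_linorder by (auto simp: w_def X_def)
  have z_nonneg: "0 \<le> z $ i" for i
    using feasible_z(1) by (simp add: less_eq_vec_def)
  have abs_\<beta>: "\<bar>\<beta> $ i\<bar> = z $ i" for i
    by (simp add: assms(16) abs_mult gs z_nonneg)
  define h where "h = \<beta> - x"
  define H where "H = (\<Sum>i\<in>S. \<bar>h $ i\<bar>)"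
  have h_off: "\<bar>h $ i\<bar> = z $ i" if "i \<notin> S" for i
    by (simp add: h_def off_S[OF that] abs_\<beta>)
  \<comment> \<open>Mass that \<open>z\<close> has off \<open>S\<close> must be saved on \<open>S\<close>, where saving it costs error.\<close>
  have cone: "(\<Sum>i\<in>-S. \<bar>h $ i\<bar>) \<le> H"
  proof -
    have "(\<Sum>i\<in>-S. \<bar>h $ i\<bar>) = (\<Sum>i\<in>-S. z $ i)"
      by (intro sum.cong) (auto simp: h_off)
    also have "\<dots> = (\<Sum>i\<in>UNIV. z $ i) - (\<Sum>i\<in>S. z $ i)"
      by (simp add: Compl_eq_Diff_UNIV sum_diff)
    also have "\<dots> \<le> (\<Sum>i\<in>S. \<bar>x $ i\<bar> - z $ i)"
      using opt by (simp add: X_S sum_subtractf)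
    also have "\<dots> \<le> H"
      unfolding H_def by (intro sum_mono) (use abs_\<beta> in \<open>simp add: h_def, smt (verit)\<close>)
    finally show ?thesis .
  qed
  have "\<bar>(Abar *v h) $ i\<bar> \<le> 2 * \<Delta>y + \<Delta>A * (2 * real k * d)" for i
  proof -
    have "\<bar>(Abar *v \<beta>) $ i - ybar $ i\<bar> \<le> \<Delta>y + \<Delta>A * (\<Sum>j\<in>UNIV. z $ j)"
      using feasible_z(2) unfolding lp_feasible_iff assms(16) by blast
    moreover have "\<Delta>A * (\<Sum>j\<in>UNIV. z $ j) \<le> \<Delta>A * (real k * d)" "\<Delta>A * X \<le> \<Delta>A * (real k * d)"
      using opt X_le \<Delta> by (auto intro!: mult_left_mono)
    moreover have "(Abar *v h) $ i = (Abar *v \<beta>) $ i - (Abar *v x) $ i"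
      by (simp add: h_def matrix_vector_mult_diff_distrib)
    ultimately show ?thesis using fit_x[of i] by (simp add: algebra_simps)
  qed
  then have "norm (Abar *v h) \<le> sqrt (real CARD('m)) * (2 * \<Delta>y + \<Delta>A * (2 * real k * d))"
    by (rule norm_le_sqrt_card)
  define \<psi> where "\<psi> = sqrt (real CARD('m)) * (2 * \<Delta>y + \<Delta>A * (2 * real k * d))"
  obtain \<xi> where \<xi>: "0 < \<xi>" "\<phi> * real k \<le> \<tau> * \<xi>" "coherence S Abar \<le> 1 - 2 * \<xi>"
    using assms(21) by blast
  have H_nonneg: "0 \<le> H" by (simp add: H_def sum_nonneg)
  have "2 * \<xi> * H \<le> (1 - coherence S Abar) * H"
    using \<xi>(3) H_nonneg by (intro mult_right_mono) auto
  also have "\<dots> \<le> real k * norm (Abar *v h)"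
    unfolding H_def assms(4) using assms(13) cone by (intro coherence_cone_bound) (auto simp: H_def)
  also have "\<dots> \<le> \<psi> * real k"
    using \<open>norm (Abar *v h) \<le> _\<close> by (simp add: \<psi>_def mult.commute mult_left_mono)
  finally have H_\<psi>: "2 * \<xi> * H \<le> \<psi> * real k" .
  have h_le_H: "\<bar>h $ i\<bar> \<le> H" for i
  proof (cases "i \<in> S")
    case True then show ?thesis unfolding H_def by (intro member_le_sum) auto
  next
    case False
    then have "\<bar>h $ i\<bar> \<le> (\<Sum>i\<in>-S. \<bar>h $ i\<bar>)" by (intro member_le_sum) auto
    with cone show ?thesis by simp
  qed
  \<comment> \<open>First pass of the bootstrap, with the factor \<open>2\<close> lost by not knowing that
    \<open>k \<le> khat\<close>.\<close>
  have "k \<le> khat"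
  proof -
    have "\<Delta>A * (2 * real k * d) \<le> \<Delta>A * (2 * real (k + khat) * d)"
      using \<Delta> d_nonneg by (intro mult_left_mono mult_right_mono) auto
    then have "2 * \<Delta>y + \<Delta>A * (2 * real k * d) \<le> 2 * (2 * \<Delta>y + \<Delta>A * real (k + khat) * d)"
      using \<Delta> by (simp add: algebra_simps)
    then have "\<psi> \<le> 2 * \<phi>"
      unfolding \<psi>_def assms(18) mult.left_commute[of 2] by (intro mult_left_mono) auto
    then have "\<psi> * real k \<le> 2 * (\<phi> * real k)"
      using mult_right_mono[of \<psi> "2 * \<phi>" "real k"] by simp
    then have "\<xi> * H \<le> \<xi> * \<tau>" using H_\<psi> \<xi>(2) by (simp add: mult.commute)
    then have "H \<le> \<tau>" using \<xi>(1) by simp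
    have "S \<subseteq> support \<beta>"
    proof
      fix i assume "i \<in> S"
      then have "\<bar>h $ i\<bar> < \<bar>x $ i\<bar>"
        using h_le_H[of i] x_ge[of i] \<open>H \<le> \<tau>\<close> assms(19,20) by linarith
      then show "i \<in> support \<beta>" by (auto simp: support_def h_def)
    qed
    then show ?thesis unfolding assms(4,17) by (intro card_mono) auto
  qed
  \<comment> \<open>Second pass, which yields the strict inequality that polishing needs off \<open>S\<close>.\<close>
  have "\<Delta>A * (2 * real k * d) \<le> \<Delta>A * (real (k + khat) * d)"
    using \<Delta> d_nonneg \<open>k \<le> khat\<close> by (intro mult_left_mono mult_right_mono) auto
  then have "\<psi> \<le> \<phi>"
    unfolding \<psi>_def assms(18) by (intro mult_left_mono) (auto simp: mult.assoc)
  then have "\<psi> * real k \<le> \<phi> * real k" by (intro mult_right_mono) auto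
  then have "\<xi> * (2 * H) \<le> \<xi> * \<tau>" using H_\<psi> \<xi>(2) by (simp add: mult.commute mult.left_commute)
  then have H_small: "2 * H \<le> \<tau>" using \<xi>(1) by simp
  have "\<not> \<bar>\<beta> $ i\<bar> < \<tau> \<longleftrightarrow> i \<in> S" for i
  proof (cases "i \<in> S")
    case True
    have "\<bar>x $ i\<bar> \<le> \<bar>\<beta> $ i\<bar> + \<bar>h $ i\<bar>" by (simp add: h_def)
    with True x_ge[of i] h_le_H[of i] H_small assms(19,20) show ?thesis by linarith
  next
    case False
    then have "\<bar>\<beta> $ i\<bar> = \<bar>h $ i\<bar>" by (simp add: h_def off_S)
    with False h_le_H[of i] H_small assms(19) show ?thesis by linarith
  qed
  moreover have "\<beta> $ i \<noteq> 0" if "\<not> \<bar>\<beta> $ i\<bar> < \<tau>" for i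
    using that assms(19) by auto
  ultimately show ?thesis by (simp add: support_def polish_def set_eq_iff) blast
qed

end
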